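(* For any $\mathbb{T}$-gain digraph $\Phi=(D,\varphi)$, $\rho(\Phi)\le\Delta^+$.
   Context: A digraph $D=(V,\mathcal{A})$ has a finite vertex set $V=\{v_1,\dots,v_n\}$ and a set $\mathcal{A}$ of ordered pairs of distinct vertices, called arcs (no loops; at most one arc from $v_i$ to $v_j$ for each ordered pair; opposite arcs may both be present). The out-degree $\deg^+(v)$ is the number of arcs leaving $v$, and $\Delta^+=\max_i\deg^+(v_i)$. Let $\mathbb{T}=\{z\in\mathbb{C}:|z|=1\}$. A $\mathbb{T}$-gain digraph is a pair $\Phi=(D,\varphi)$ with $\varphi:\mathcal{A}\to\mathbb{T}$ an arbitrary function. Its gain adjacency matrix $A(\Phi)$ has entries $A(\Phi)_{ij}=\varphi(v_i,v_j)$ if $(v_i,v_j)\in\mathcal{A}$ and $0$ otherwise. $\rho(\Phi)$ is the spectral radius (maximum modulus of a complex eigenvalue) of $A(\Phi)$. *)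

theory Defs
  imports "Graph_Theory.Pair_Digraph" "Jordan_Normal_Form.Spectral_Radius" "HOL-Library.FuncSet"
begin

text \<open>
  The arc set of a \<^locale>\<open>pair_digraph\<close> is a set of ordered pairs, so parallel arcs are
  excluded by construction.  The null graph is excluded because neither the maximum out-degree
  nor the spectral radius is defined for it.  The gain function is a total HOL function, but
  only its values on arcs are constrained or used.
\<close>

locale t_gain_digraph = pair_digraph D for D :: "'a pair_pre_digraph" +
  fixes gain :: "'a \<times> 'a \<Rightarrow> complex"
  assumes verts_nonempty: "pverts D \<noteq> {}"
    and gain_unit: "gain \<in> parcs D \<rightarrow> {z. norm z = 1}"

definition max_out_degree :: "('a, 'b) pre_digraph \<Rightarrow> nat" where
  "max_out_degree G = Max (out_degree G ` verts G)"

text \<open>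
  The matrix depends on an enumeration of the vertices, given as a list in which every vertex
  occurs exactly once; indices start at 0.
\<close>

definition vertex_enumeration :: "'a pair_pre_digraph \<Rightarrow> 'a list \<Rightarrow> bool" where
  "vertex_enumeration D vs \<longleftrightarrow> distinct vs \<and> set vs = pverts D"

definition gain_adjacency_matrix ::
    "'a pair_pre_digraph \<Rightarrow> ('a \<times> 'a \<Rightarrow> complex) \<Rightarrow> 'a list \<Rightarrow> complex mat" where
  "gain_adjacency_matrix D gain vs =
     mat (length vs) (length vs)
       (\<lambda>(i, j). if (vs ! i, vs ! j) \<in> parcs D then gain (vs ! i, vs ! j) else 0)"

end

theory Submission
  imports Defs
begin

text \<open>The spectral radius is at most the largest absolute row sum, the operator norm induced
  by the sup norm. If \<open>A v = k v\<close> and the entry of \<open>v\<close> at \<open>i\<close>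
  has maximal modulus \<open>m > 0\<close>, then row \<open>i\<close> of this equation and the
  triangle inequality give \<open>norm k * m \<le> c * m\<close>, and \<open>m\<close> cancels
  (\<open>eigenvalue_norm_le_row_sum\<close>). For a gain matrix the absolute row sums are exactly
  the out-degrees (\<open>gain_adjacency_matrix_row_sum\<close>), so \<open>c\<close> can be the
  maximum out-degree.\<close>

lemma eigenvalue_norm_le_row_sum:
  fixes A :: "'a :: real_normed_field mat"
  assumes A: "A \<in> carrier_mat n n"
    and rows: "\<And>i. i < n \<Longrightarrow> (\<Sum>j<n. norm (A $$ (i, j))) \<le> c"
    and ev: "eigenvalue A k"
  shows "norm k \<le> c"
proof -
  obtain v where v: "v \<in> carrier_vec n" and v0: "v \<noteq> 0\<^sub>v n" and Av: "A *\<^sub>v v = k \<cdot>\<^sub>v v"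
    using ev A unfolding eigenvalue_def eigenvector_def by auto
  obtain l where l: "l < n" "v $ l \<noteq> 0"
    using v v0 by (metis eq_vecI carrier_vecD index_zero_vec)
  define m where "m = Max ((\<lambda>j. norm (v $ j)) ` {..<n})"
  have m_ge: "norm (v $ j) \<le> m" if "j < n" for j
    unfolding m_def using that by (intro Max_ge) auto
  have "m \<in> (\<lambda>j. norm (v $ j)) ` {..<n}"
    unfolding m_def using l by (intro Max_in) auto
  then obtain i where i: "i < n" "norm (v $ i) = m" by auto
  \<comment> \<open>Here \<open>v\<close> being nonzero enters; strict positivity permits the final
    cancellation of \<open>m\<close>.\<close>
  have "m > 0" using m_ge[OF l(1)] l(2) by (meson less_le_trans zero_less_norm_iff)
  have "k * v $ i = (A *\<^sub>v v) $ i" using Av v i by simp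
  also have "\<dots> = (\<Sum>j<n. A $$ (i, j) * v $ j)"
    using A v i by (auto simp: scalar_prod_def atLeast0LessThan intro!: sum.cong)
  finally have "norm k * m = norm (\<Sum>j<n. A $$ (i, j) * v $ j)"
    by (metis i(2) norm_mult)
  also have "\<dots> \<le> (\<Sum>j<n. norm (A $$ (i, j)) * m)"
    by (intro sum_norm_le) (auto simp: norm_mult intro!: mult_left_mono m_ge)
  also have "\<dots> \<le> c * m"
    using rows[OF i(1)] \<open>m > 0\<close> by (simp flip: sum_distrib_right)
  finally show ?thesis using \<open>m > 0\<close> by simp
qed

text \<open>Gains on arcs have modulus 1 and all other entries vanish, so taking norms forgets the
  gains and counts out-neighbours.\<close>

lemma (in t_gain_digraph) gain_adjacency_matrix_row_sum:
  assumes vs: "vertex_enumeration D vs" and i: "i < length vs"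
  shows "(\<Sum>j<length vs. norm (gain_adjacency_matrix D gain vs $$ (i, j)))
           = real (out_degree (with_proj D) (vs ! i))"
proof -
  let ?N = "{w. (vs ! i, w) \<in> parcs D}"
  have dist: "distinct vs" and set: "set vs = pverts D"
    using vs by (auto simp: vertex_enumeration_def)
  have N: "?N \<subseteq> set vs" using set in_arcsD2 by auto
  have "(\<Sum>j<length vs. norm (gain_adjacency_matrix D gain vs $$ (i, j)))
          = (\<Sum>j<length vs. if vs ! j \<in> ?N then 1 else 0)"
    using i gain_unit by (intro sum.cong) (auto simp: gain_adjacency_matrix_def)
  \<comment> \<open>Distinctness of \<open>vs\<close> makes \<open>(!) vs\<close> a bijection from
    indices to vertices, so no out-neighbour is counted twice.\<close>
  also have "\<dots> = (\<Sum>w\<in>set vs. if w \<in> ?N then 1 else 0)"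
    by (rule sum.reindex_bij_betw[OF bij_betw_nth[OF dist]]) auto
  also have "\<dots> = real (card ?N)"
    using N by (simp add: sum.If_cases Int_absorb1)
  \<comment> \<open>\<open>out_degree\<close> counts arcs rather than their heads; with a fixed tail
    the two correspond bijectively.\<close>
  also have "card ?N = card (Pair (vs ! i) ` ?N)"
    by (simp add: card_image inj_on_def)
  also have "Pair (vs ! i) ` ?N = out_arcs (with_proj D) (vs ! i)"
    by (auto simp: out_arcs_def)
  finally show ?thesis by (simp add: out_degree_def)
qed

theorem theorem3p8:
  fixes D :: "'a pair_pre_digraph" and gain :: "'a \<times> 'a \<Rightarrow> complex" and vs :: "'a list"
  assumes "t_gain_digraph D gain"
    and "vertex_enumeration D vs"
  shows "spectral_radius (gain_adjacency_matrix D gain vs)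
           \<le> real (max_out_degree (with_proj D))"
proof -
  interpret t_gain_digraph D gain by fact
  let ?A = "gain_adjacency_matrix D gain vs" and ?n = "length vs"
  have set: "set vs = pverts D" using assms(2) by (simp add: vertex_enumeration_def)
  have A: "?A \<in> carrier_mat ?n ?n" by (simp add: gain_adjacency_matrix_def)
  \<comment> \<open>Positive dimension guarantees a complex eigenvalue, so the spectral radius is
    attained by some \<open>k\<close>.\<close>
  have n: "?n > 0" using set verts_nonempty by auto
  have rows: "(\<Sum>j<?n. norm (?A $$ (i, j))) \<le> real (max_out_degree (with_proj D))"
    if "i < ?n" for i
  proof -
    have "vs ! i \<in> pverts D" using that set nth_mem by blast
    then have "out_degree (with_proj D) (vs ! i) \<le> max_out_degree (with_proj D)"
      unfolding max_out_degree_def by (intro Max_ge) auto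
    then show ?thesis
      using gain_adjacency_matrix_row_sum[OF assms(2) that] by simp
  qed
  obtain k where "eigenvalue ?A k" "spectral_radius ?A = norm k"
    using spectral_radius_mem_max(1)[OF A n] by (auto simp: spectrum_def)
  then show ?thesis using eigenvalue_norm_le_row_sum[OF A rows] by simp
qed

end
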